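(* Let $\sum_{i=0}^{\infty}a_i$ be a computable convergent series of nonnegative rational numbers. Then there exists a probabilistic algorithm that, with probability $1$, outputs an infinite binary sequence $\omega$ for which there is a constant $c$ such that $$K(\omega([k,k+n)))\ge a_{\lfloor\log_2 n\rfloor}\, n-c$$ for all natural numbers $k$ and all positive integers $n$.
   Context: A probabilistic algorithm is an algorithm that has access to a source of independent fair random bits and outputs binary digits one after another. A computable series of nonnegative rationals means the map $i\mapsto a_i$ is computable. For an infinite binary sequence $\omega=\omega_0\omega_1\dots$, $\omega([i,j))$ denotes the substring $\omega_i\omega_{i+1}\dots\omega_{j-1}$. $K(u)$ denotes the Kolmogorov complexity of a binary string $u$ (minimal length of a program producing $u$ with respect to a fixed optimal decompressor). *)

theory Defs
  imports "HOL-Probability.Probability"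
begin

datatype recf = Z | S | Id nat | Cn recf "recf list" | Pr recf recf | Mn recf

inductive eval :: "recf \<Rightarrow> nat list \<Rightarrow> nat \<Rightarrow> bool" where
  eval_Z: "eval Z xs 0"
| eval_S: "eval S (x # xs) (Suc x)"
| eval_Id: "k < length xs \<Longrightarrow> eval (Id k) xs (xs ! k)"
| eval_Cn: "list_all2 (\<lambda>g y. eval g xs y) gs ys \<Longrightarrow> eval f ys z \<Longrightarrow> eval (Cn f gs) xs z"
| eval_Pr0: "eval f xs y \<Longrightarrow> eval (Pr f g) (0 # xs) y"
| eval_PrS: "eval (Pr f g) (n # xs) y \<Longrightarrow> eval g (y # n # xs) z \<Longrightarrow> eval (Pr f g) (Suc n # xs) z"
| eval_Mn: "eval f (n # xs) 0 \<Longrightarrow> (\<forall>m<n. \<exists>y. eval f (m # xs) y \<and> y \<noteq> 0) \<Longrightarrow> eval (Mn f) xs n"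

definition partial_computable :: "(nat \<Rightarrow> nat option) \<Rightarrow> bool" where
  "partial_computable \<phi> \<longleftrightarrow> (\<exists>f. \<forall>x y. eval f [x] y \<longleftrightarrow> \<phi> x = Some y)"

definition computable :: "(nat \<Rightarrow> nat) \<Rightarrow> bool" where
  "computable h \<longleftrightarrow> partial_computable (\<lambda>x. Some (h x))"

text \<open>Bijective encoding of binary strings as natural numbers.\<close>
fun enc :: "bool list \<Rightarrow> nat" where
  "enc [] = 0"
| "enc (b # bs) = 2 * enc bs + (if b then 2 else 1)"

definition dec :: "nat \<Rightarrow> bool list" where
  "dec n = (THE u. enc u = n)"

definition partial_computable_str :: "(bool list \<Rightarrow> bool list option) \<Rightarrow> bool" where
  "partial_computable_str D \<longleftrightarrow> partial_computable (\<lambda>x. map_option enc (D (dec x)))"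

definition computable_str :: "(bool list \<Rightarrow> bool list) \<Rightarrow> bool" where
  "computable_str M \<longleftrightarrow> computable (\<lambda>x. enc (M (dec x)))"

definition optimal_decompressor :: "(bool list \<Rightarrow> bool list option) \<Rightarrow> bool" where
  "optimal_decompressor D \<longleftrightarrow> partial_computable_str D \<and>
     (\<forall>D'. partial_computable_str D' \<longrightarrow>
        (\<exists>c::nat. \<forall>p u. D' p = Some u \<longrightarrow> (\<exists>q. D q = Some u \<and> length q \<le> length p + c)))"

definition KC :: "(bool list \<Rightarrow> bool list option) \<Rightarrow> bool list \<Rightarrow> nat" where
  "KC D u = (LEAST l. \<exists>p. D p = Some u \<and> length p = l)"

text \<open>A probabilistic algorithm is modelled as a total computable map M that is
  monotone w.r.t. prefixes: M r is the output produced after reading the random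
  bits r.  On an infinite random sequence, the output is the union of the
  outputs on its finite prefixes.\<close>
definition prob_algorithm :: "(bool list \<Rightarrow> bool list) \<Rightarrow> bool" where
  "prob_algorithm M \<longleftrightarrow> computable_str M \<and> (\<forall>r s. prefix r s \<longrightarrow> prefix (M r) (M s))"

definition outputs_infinite :: "(bool list \<Rightarrow> bool list) \<Rightarrow> (nat \<Rightarrow> bool) \<Rightarrow> (nat \<Rightarrow> bool) \<Rightarrow> bool" where
  "outputs_infinite M r \<omega> \<longleftrightarrow>
     (\<forall>i. \<exists>n. i < length (M (map r [0..<n])) \<and> M (map r [0..<n]) ! i = \<omega> i)"

definition coin :: "(nat \<Rightarrow> bool) measure" where
  "coin = PiM UNIV (\<lambda>_. measure_pmf (bernoulli_pmf (1/2)))"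

definition substr :: "(nat \<Rightarrow> bool) \<Rightarrow> nat \<Rightarrow> nat \<Rightarrow> bool list" where
  "substr \<omega> i j = map \<omega> [i..<j]"

definition computable_rat_seq :: "(nat \<Rightarrow> rat) \<Rightarrow> bool" where
  "computable_rat_seq a \<longleftrightarrow> (\<exists>p q. computable p \<and> computable q \<and>
     (\<forall>i. q i > 0 \<and> a i = of_nat (p i) / of_nat (q i)))"

end

theory Submission
  imports Defs
begin

text \<open>Reserve for every large \<open>i\<close> a set of positions, periodic with period \<open>2 ^ i\<close> and of density
  \<open>L i / 2 ^ i\<close> with \<open>L i\<close> about \<open>2 ^ (i + 1) * a i + 2 * i\<close>. These densities are summable, so from
  some level on the sets can be chosen disjoint. Fill the \<open>i\<close>-th set with \<open>L i\<close> random bits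
  repeated periodically. A substring of length \<open>n\<close> with \<open>2 ^ i \<le> n < 2 ^ (i + 1)\<close> contains all of them,
  so the substring and its position modulo \<open>2 ^ i\<close> determine these bits. Counting programs shorter
  than \<open>a i * 2 ^ (i + 1)\<close>, the probability that some substring of such a length is too simple is at
  most \<open>2 ^ (- i)\<close>, and the Borel-Cantelli lemma applies; the constant \<open>c\<close> absorbs the finitely many
  remaining levels.\<close>

section \<open>Closure properties of total recursive functions of fixed arity\<close>

definition computable_fn :: "nat \<Rightarrow> (nat list \<Rightarrow> nat) \<Rightarrow> bool" where
  "computable_fn k F \<longleftrightarrow> (\<exists>f. \<forall>xs y. length xs = k \<longrightarrow> (eval f xs y \<longleftrightarrow> y = F xs))"

lemma computable_fn_cong:
  assumes "computable_fn k F" "\<And>xs. length xs = k \<Longrightarrow> F xs = G xs"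
  shows "computable_fn k G"
  using assms unfolding computable_fn_def by metis

inductive_cases eval_ZE: "eval Z xs y"
inductive_cases eval_SE: "eval S xs y"
inductive_cases eval_IdE: "eval (Id k) xs y"
inductive_cases eval_CnE: "eval (Cn f gs) xs y"
inductive_cases eval_Pr0E: "eval (Pr f g) (0 # xs) y"
inductive_cases eval_PrSE: "eval (Pr f g) (Suc n # xs) y"

lemma computable_fn_nth:
  assumes "i < k"
  shows "computable_fn k (\<lambda>xs. xs ! i)"
  unfolding computable_fn_def
  by (rule exI[of _ "Id i"]) (use assms in \<open>auto elim: eval_IdE intro: eval.intros\<close>)

lemma computable_fn_comp:
  assumes "computable_fn (length Gs) F" "\<And>G. G \<in> set Gs \<Longrightarrow> computable_fn k G"
  shows "computable_fn k (\<lambda>xs. F (map (\<lambda>G. G xs) Gs))"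
proof -
  obtain f where f: "\<And>xs y. length xs = length Gs \<Longrightarrow> eval f xs y \<longleftrightarrow> y = F xs"
    using assms(1) unfolding computable_fn_def by blast
  obtain h where h: "\<And>G xs y. G \<in> set Gs \<Longrightarrow> length xs = k \<Longrightarrow> eval (h G) xs y \<longleftrightarrow> y = G xs"
    using assms(2) unfolding computable_fn_def by metis
  have *: "list_all2 (\<lambda>g y. eval g xs y) (map h Gs) ys \<longleftrightarrow> ys = map (\<lambda>G. G xs) Gs"
    if "length xs = k" for xs ys
    using h that by (auto simp: list_all2_conv_all_nth intro!: nth_equalityI)
  have "eval (Cn f (map h Gs)) xs y \<longleftrightarrow> y = F (map (\<lambda>G. G xs) Gs)" if "length xs = k" for xs y
  proof
    assume "eval (Cn f (map h Gs)) xs y"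
    then show "y = F (map (\<lambda>G. G xs) Gs)"
      by (rule eval_CnE) (use * f that in auto)
  next
    assume "y = F (map (\<lambda>G. G xs) Gs)"
    then show "eval (Cn f (map h Gs)) xs y"
      using * f that by (intro eval_Cn[of xs _ "map (\<lambda>G. G xs) Gs"]) auto
  qed
  then show ?thesis
    unfolding computable_fn_def by blast
qed

lemma computable_fn_tl:
  assumes "computable_fn k F"
  shows "computable_fn (Suc k) (\<lambda>xs. F (tl xs))"
proof (rule computable_fn_cong)
  show "computable_fn (Suc k) (\<lambda>xs. F (map (\<lambda>G. G xs) (map (\<lambda>i xs. xs ! Suc i) [0..<k])))"
    using assms by (intro computable_fn_comp) (auto intro: computable_fn_nth)
  show "F (map (\<lambda>G. G xs) (map (\<lambda>i xs. xs ! Suc i) [0..<k])) = F (tl xs)"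
    if "length xs = Suc k" for xs
    using that by (intro arg_cong[of _ _ F] nth_equalityI) (auto simp: nth_tl)
qed

lemma computable_fn_hd: "computable_fn (Suc k) hd"
  by (rule computable_fn_cong[OF computable_fn_nth[of 0]]) (auto simp: hd_conv_nth length_Suc_conv)

lemma computable_fn_Suc:
  assumes "computable_fn k F"
  shows "computable_fn k (\<lambda>xs. Suc (F xs))"
proof -
  have "computable_fn (Suc 0) (\<lambda>xs. Suc (hd xs))"
    unfolding computable_fn_def
    by (rule exI[of _ S]) (auto simp: length_Suc_conv elim: eval_SE intro: eval.intros)
  from computable_fn_comp[of "[F]", simplified, OF this assms] show ?thesis by simp
qed

lemma computable_fn_const: "computable_fn k (\<lambda>_. c)"
proof (induction c)
  case 0
  show ?case
    unfolding computable_fn_def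
    by (rule exI[of _ Z]) (auto elim: eval_ZE intro: eval.intros)
next
  case (Suc c)
  then show ?case by (rule computable_fn_Suc)
qed

lemma computable_fn_computable:
  assumes "computable h" "computable_fn k F"
  shows "computable_fn k (\<lambda>xs. h (F xs))"
proof -
  obtain f where "\<And>x y. eval f [x] y \<longleftrightarrow> y = h x"
    using assms(1) unfolding computable_def partial_computable_def by (metis option.inject)
  then have "computable_fn (Suc 0) (\<lambda>xs. h (hd xs))"
    unfolding computable_fn_def by (intro exI[of _ f]) (auto simp: length_Suc_conv)
  from computable_fn_comp[of "[F]", simplified, OF this assms(2)] show ?thesis by simp
qed

text \<open>\<open>Pr\<close> keeps its counter at the head of the argument list and hands the step
  function the previous value, then the counter, then the parameters. Composing it with
  \<open>N\<close> and all projections hides this convention, so recursions can be stated pointwise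
  in \<open>xs\<close> with a bound that depends on \<open>xs\<close>.\<close>

lemma computable_fn_rec:
  assumes "computable_fn k F"
    and "computable_fn (Suc (Suc k)) (\<lambda>zs. G (hd (tl zs)) (hd zs) (tl (tl zs)))"
    and "computable_fn k N"
  shows "computable_fn k (\<lambda>xs. rec_nat (F xs) (\<lambda>n y. G n y xs) (N xs))"
proof -
  obtain f where f: "\<And>xs y. length xs = k \<Longrightarrow> eval f xs y \<longleftrightarrow> y = F xs"
    using assms(1) unfolding computable_fn_def by blast
  obtain g where g: "\<And>y n xs z. length xs = k \<Longrightarrow> eval g (y # n # xs) z \<longleftrightarrow> z = G n y xs"
    using assms(2) unfolding computable_fn_def
    by (metis length_Cons list.sel(1) list.sel(3))
  have *: "eval (Pr f g) (n # xs) y \<longleftrightarrow> y = rec_nat (F xs) (\<lambda>n y. G n y xs) n"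
    if "length xs = k" for n xs y
  proof (induction n arbitrary: y)
    case 0
    then show ?case using f that by (auto elim: eval_Pr0E intro: eval.intros)
  next
    case (Suc n)
    then show ?case using g that by (auto elim!: eval_PrSE intro: eval.intros)
  qed
  have "computable_fn (Suc k) (\<lambda>zs. rec_nat (F (tl zs)) (\<lambda>n y. G n y (tl zs)) (hd zs))"
    unfolding computable_fn_def
    by (rule exI[of _ "Pr f g"]) (auto simp: length_Suc_conv *)
  moreover have "computable_fn k G'" if "G' \<in> set (N # map (\<lambda>i xs. xs ! i) [0..<k])" for G'
    using that assms(3) by (auto intro: computable_fn_nth)
  ultimately have "computable_fn k (\<lambda>xs. (\<lambda>zs. rec_nat (F (tl zs)) (\<lambda>n y. G n y (tl zs)) (hd zs))
      (map (\<lambda>G. G xs) (N # map (\<lambda>i xs. xs ! i) [0..<k])))"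
    by (intro computable_fn_comp) auto
  then show ?thesis
  proof (rule computable_fn_cong)
    fix xs :: "nat list" assume "length xs = k"
    then have "map (\<lambda>i. xs ! i) [0..<k] = xs" by (metis map_nth)
    then show "(\<lambda>zs. rec_nat (F (tl zs)) (\<lambda>n y. G n y (tl zs)) (hd zs))
      (map (\<lambda>G. G xs) (N # map (\<lambda>i xs. xs ! i) [0..<k])) =
      rec_nat (F xs) (\<lambda>n y. G n y xs) (N xs)"
      by (simp add: comp_def)
  qed
qed

lemma computable_fn_tl_tl:
  assumes "computable_fn k F"
  shows "computable_fn (Suc (Suc k)) (\<lambda>xs. F (tl (tl xs)))"
  using computable_fn_tl[OF computable_fn_tl[OF assms]] .

lemma computable_fn_hd_tl: "computable_fn (Suc (Suc k)) (\<lambda>xs. hd (tl xs))"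
  using computable_fn_tl[OF computable_fn_hd] .

lemma computable_fn_add:
  assumes "computable_fn k F" "computable_fn k G"
  shows "computable_fn k (\<lambda>xs. F xs + G xs)"
proof -
  have "computable_fn k (\<lambda>xs. rec_nat (F xs) (\<lambda>n y. Suc y) (G xs))"
    by (intro computable_fn_rec computable_fn_Suc computable_fn_hd assms)
  moreover have "rec_nat a (\<lambda>n y. Suc y) b = a + b" for a b by (induction b) auto
  ultimately show ?thesis by simp
qed

lemma computable_fn_mult:
  assumes "computable_fn k F" "computable_fn k G"
  shows "computable_fn k (\<lambda>xs. F xs * G xs)"
proof -
  have "computable_fn k (\<lambda>xs. rec_nat 0 (\<lambda>n y. y + F xs) (G xs))"
    by (intro computable_fn_rec computable_fn_add computable_fn_hd computable_fn_const
        computable_fn_tl_tl assms)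
  moreover have "rec_nat 0 (\<lambda>n y. y + a) b = a * b" for a b :: nat by (induction b) auto
  ultimately show ?thesis by simp
qed

lemma computable_fn_power:
  assumes "computable_fn k F" "computable_fn k G"
  shows "computable_fn k (\<lambda>xs. F xs ^ G xs)"
proof -
  have "computable_fn k (\<lambda>xs. rec_nat 1 (\<lambda>n y. F xs * y) (G xs))"
    by (intro computable_fn_rec computable_fn_mult computable_fn_hd computable_fn_const
        computable_fn_tl_tl assms)
  moreover have "rec_nat 1 (\<lambda>n y. a * y) b = a ^ b" for a b :: nat by (induction b) auto
  ultimately show ?thesis by simp
qed

lemma computable_fn_diff:
  assumes "computable_fn k F" "computable_fn k G"
  shows "computable_fn k (\<lambda>xs. F xs - G xs)"
proof -
  have pred: "computable_fn j (\<lambda>xs. H xs - 1)" if "computable_fn j H" for j H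
  proof -
    have "computable_fn j (\<lambda>xs. rec_nat 0 (\<lambda>n y. n) (H xs))"
      by (intro computable_fn_rec computable_fn_hd_tl computable_fn_const that)
    moreover have "rec_nat 0 (\<lambda>n y. n) b = b - 1" for b :: nat by (cases b) auto
    ultimately show ?thesis by simp
  qed
  have "computable_fn k (\<lambda>xs. rec_nat (F xs) (\<lambda>n y. y - 1) (G xs))"
    by (intro computable_fn_rec pred computable_fn_hd assms)
  moreover have "rec_nat a (\<lambda>n y. y - 1) b = a - b" for a b :: nat by (induction b) auto
  ultimately show ?thesis by simp
qed

lemma computable_fn_sum:
  assumes "computable_fn (Suc k) (\<lambda>zs. F (hd zs) (tl zs))" "computable_fn k B"
  shows "computable_fn k (\<lambda>xs. \<Sum>j<B xs. F j xs)"
proof -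
  have "computable_fn (Suc (Suc k)) (\<lambda>zs. F (hd (tl zs)) (tl (tl zs)))"
    using computable_fn_tl[OF assms(1)] .
  then have "computable_fn k (\<lambda>xs. rec_nat 0 (\<lambda>n y. y + F n xs) (B xs))"
    by (intro computable_fn_rec computable_fn_add computable_fn_hd computable_fn_const assms)
  moreover have "rec_nat 0 (\<lambda>n y. y + f n) b = (\<Sum>j<b. f j)" for b and f :: "nat \<Rightarrow> nat"
    by (induction b) auto
  ultimately show ?thesis by simp
qed

lemma computable_fn_le:
  assumes "computable_fn k F" "computable_fn k G"
  shows "computable_fn k (\<lambda>xs. of_bool (F xs \<le> G xs))"
proof (rule computable_fn_cong)
  show "computable_fn k (\<lambda>xs. 1 - (F xs - G xs))"
    by (intro computable_fn_diff computable_fn_const assms)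
qed auto

lemma computable_fn_less:
  assumes "computable_fn k F" "computable_fn k G"
  shows "computable_fn k (\<lambda>xs. of_bool (F xs < G xs))"
  using computable_fn_le[OF computable_fn_Suc[OF assms(1)] assms(2)] by (simp add: Suc_le_eq)

lemma computable_fn_conj:
  assumes "computable_fn k (\<lambda>xs. of_bool (P xs))" "computable_fn k (\<lambda>xs. of_bool (Q xs))"
  shows "computable_fn k (\<lambda>xs. of_bool (P xs \<and> Q xs))"
  using computable_fn_mult[OF assms] by (simp add: of_bool_conj)

text \<open>Bounded search by counting: a number with decidable lower bounds is the number of
  positive lower bounds it has. Quotients and string lengths are computed in this way.\<close>

lemma sum_of_bool_Suc_le:
  assumes "l \<le> n"
  shows "(\<Sum>j<n. of_bool (Suc j \<le> l)) = (l :: nat)"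
proof -
  have "{j. j < n \<and> Suc j \<le> l} = {..<l}" using assms by auto
  then show ?thesis by (simp add: of_bool_def sum.If_cases Int_def)
qed

lemma computable_fn_div:
  assumes "computable_fn k F" "computable_fn k G"
  shows "computable_fn k (\<lambda>xs. F xs div G xs)"
proof (rule computable_fn_cong)
  \<comment> \<open>The quotient counts the positive multiples of the divisor up to
    \<open>F xs\<close>. For divisor 0 every term would be counted, while \<open>div\<close> yields
    0; the first factor corrects this.\<close>
  show "computable_fn k (\<lambda>xs. of_bool (0 < G xs) * (\<Sum>j<F xs. of_bool (Suc j * G xs \<le> F xs)))"
    by (intro computable_fn_mult computable_fn_less computable_fn_sum computable_fn_le
        computable_fn_Suc computable_fn_hd computable_fn_tl computable_fn_const assms)
  show "of_bool (0 < G xs) * (\<Sum>j<F xs. of_bool (Suc j * G xs \<le> F xs)) = F xs div G xs" for xs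
  proof (cases "G xs = 0")
    case False
    then have "Suc j * G xs \<le> F xs \<longleftrightarrow> Suc j \<le> F xs div G xs" for j
      by (simp add: less_eq_div_iff_mult_less_eq)
    then show ?thesis
      using False by (simp only: sum_of_bool_Suc_le[OF div_le_dividend]) simp
  qed simp
qed

lemma computable_fn_mod:
  assumes "computable_fn k F" "computable_fn k G"
  shows "computable_fn k (\<lambda>xs. F xs mod G xs)"
proof (rule computable_fn_cong)
  show "computable_fn k (\<lambda>xs. F xs - F xs div G xs * G xs)"
    by (intro computable_fn_diff computable_fn_mult computable_fn_div assms)
qed (simp add: minus_div_mult_eq_mod)

lemmas computable_fn_intros =
  computable_fn_hd computable_fn_hd_tl computable_fn_const computable_fn_Suc computable_fn_add
  computable_fn_mult computable_fn_power computable_fn_diff computable_fn_le computable_fn_less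
  computable_fn_conj computable_fn_div computable_fn_mod

lemma computableI:
  assumes "computable_fn (Suc 0) (\<lambda>xs. h (hd xs))"
  shows "computable h"
proof -
  obtain f where "\<And>xs y. length xs = Suc 0 \<Longrightarrow> eval f xs y \<longleftrightarrow> y = h (hd xs)"
    using assms unfolding computable_fn_def by blast
  then have "\<forall>x y. eval f [x] y \<longleftrightarrow> Some (h x) = Some y" by auto
  then show ?thesis unfolding computable_def partial_computable_def by blast
qed

section \<open>Arithmetic on codes of binary strings\<close>

lemma Suc_enc: "Suc (enc u) = 2 ^ length u + (\<Sum>j<length u. 2 ^ j * of_bool (u ! j))"
proof (induction u)
  case (Cons b u)
  have "Suc (enc (b # u)) = 2 * Suc (enc u) + of_bool b" by simp
  also have "\<dots> = 2 ^ length (b # u) + (\<Sum>j<length (b # u). 2 ^ j * of_bool ((b # u) ! j))"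
    by (simp only: Cons length_Cons sum.lessThan_Suc_shift)
      (simp add: algebra_simps sum_distrib_left del: sum_mult_of_bool_eq sum_of_bool_mult_eq)
  finally show ?case .
qed simp

lemma Suc_enc_bounds: "2 ^ length u \<le> Suc (enc u)" "Suc (enc u) < 2 ^ Suc (length u)"
  by (induction u) auto

text \<open>By \<open>Suc_enc\<close>, adding one turns bijective base two into ordinary binary: a
  leading 1 followed by the bits of \<open>u\<close>, with the first bit of \<open>u\<close> least
  significant.\<close>

lemma nth_enc: "j < length u \<Longrightarrow> Suc (enc u) div 2 ^ j mod 2 = of_bool (u ! j)"
proof (induction u arbitrary: j)
  case (Cons b u)
  have *: "Suc (enc (b # u)) = 2 * Suc (enc u) + of_bool b" by simp
  show ?case
  proof (cases j)
    case 0
    then show ?thesis using * by simp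
  next
    case (Suc i)
    have "Suc (enc (b # u)) div 2 ^ j = Suc (enc u) div 2 ^ i"
      unfolding * Suc by (simp add: div_mult2_eq)
    then show ?thesis using Cons Suc by simp
  qed
qed simp

lemma inj_enc: "enc u = enc v \<Longrightarrow> u = v"
proof (induction u arbitrary: v)
  case Nil
  then show ?case by (cases v) (auto split: if_splits)
next
  case (Cons b u)
  then obtain c w where v: "v = c # w" by (cases v) (auto split: if_splits)
  with Cons.prems have "enc u = enc w \<and> b = c" by (auto split: if_splits; presburger)
  with Cons.IH v show ?case by auto
qed

lemma dec_enc [simp]: "dec (enc u) = u"
  unfolding dec_def using inj_enc by blast

lemma ex_enc: "\<exists>u. enc u = n"
proof (induction n rule: less_induct)
  case (less n)
  show ?case
  proof (cases "n = 0")
    case True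
    then show ?thesis by (intro exI[of _ "[]"]) simp
  next
    case False
    then have "(n - 1) div 2 < n" by simp
    then obtain u where "enc u = (n - 1) div 2" using less by blast
    \<comment> \<open>The digits of bijective base two are 1 and 2; a positive even number has last
      digit 2, which stands for \<open>True\<close>.\<close>
    then have "enc (even n # u) = n" using False by simp presburger
    then show ?thesis by blast
  qed
qed

lemma enc_dec [simp]: "enc (dec n) = n"
  by (metis dec_enc ex_enc)

text \<open>This is the shape of the final algorithm: output bit \<open>m\<close> copies input bit
  \<open>g m\<close>, which has already been read because \<open>g m\<close> is at most
  \<open>m\<close>. On codes the map becomes arithmetic.\<close>

lemma computable_str_map_nth:
  assumes g: "computable_fn (Suc 0) (\<lambda>xs. g (hd xs))" and le: "\<And>m. g m \<le> m"
  shows "computable_str (\<lambda>r. map (\<lambda>m. r ! g m) [0..<length r])"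
proof -
  \<comment> \<open>\<open>Suc (enc r)\<close> lies between 2 to the length of \<open>r\<close> and
    twice that power, so counting the powers of two below it recovers the length.\<close>
  define len :: "nat \<Rightarrow> nat" where "len x = (\<Sum>j<Suc x. of_bool (2 ^ Suc j \<le> Suc x))" for x
  have len: "len (enc r) = length r" for r
  proof -
    have "2 ^ Suc j \<le> Suc (enc r) \<longleftrightarrow> Suc j \<le> length r" for j
    proof
      assume "2 ^ Suc j \<le> Suc (enc r)"
      then have "2 ^ Suc j < (2::nat) ^ Suc (length r)" using Suc_enc_bounds(2)[of r] by linarith
      then show "Suc j \<le> length r" by (simp add: power_strict_increasing_iff)
    next
      assume "Suc j \<le> length r"
      then have "2 ^ Suc j \<le> (2::nat) ^ length r" by (intro power_increasing) auto
      then show "2 ^ Suc j \<le> Suc (enc r)" using Suc_enc_bounds(1)[of r] by linarith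
    qed
    moreover have "length r \<le> Suc (enc r)"
      using less_exp[of "length r"] Suc_enc_bounds(1)[of r] by linarith
    ultimately show ?thesis unfolding len_def by (simp only: sum_of_bool_Suc_le)
  qed
  \<comment> \<open>The sum assembles the copied bits under a leading 1; the final
    \<open>- 1\<close> undoes the shift in \<open>Suc_enc\<close>.\<close>
  define h where
    "h x = 2 ^ len x + (\<Sum>j<len x. 2 ^ j * (Suc x div 2 ^ g j mod 2)) - 1" for x
  have h: "enc (map (\<lambda>m. r ! g m) [0..<length r]) = h (enc r)" for r
  proof -
    have "g j < length r" if "j < length r" for j using le[of j] that by linarith
    then have "Suc (enc (map (\<lambda>m. r ! g m) [0..<length r])) =
        2 ^ length r + (\<Sum>j<length r. 2 ^ j * (Suc (enc r) div 2 ^ g j mod 2))"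
      unfolding Suc_enc[of "map _ _"] by (simp add: nth_enc)
    then show ?thesis unfolding h_def len by simp
  qed
  have gc: "computable_fn k (\<lambda>xs. g (F xs))" if "computable_fn k F" for k F
    using computable_fn_computable[OF computableI[OF g] that] .
  have "computable h"
    unfolding h_def len_def
    by (intro computableI computable_fn_intros computable_fn_sum gc)
  then show ?thesis
    unfolding computable_str_def by (simp add: h)
qed

section \<open>Bit reversal (van der Corput radical inverse) and the disjoint periodic levels of
  positions\<close>

primrec reverse_bits :: "nat \<Rightarrow> nat \<Rightarrow> nat" where
  "reverse_bits 0 x = 0"
| "reverse_bits (Suc i) x = 2 * reverse_bits i x + x div 2 ^ i mod 2"

lemma reverse_bits_less: "reverse_bits i x < 2 ^ i"
proof (induction i)
  case (Suc i)
  have "x div 2 ^ i mod 2 < 2" by simp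
  then show ?case using Suc by (simp only: reverse_bits.simps power_Suc)
qed simp

lemma reverse_bits_mod: "i \<le> j \<Longrightarrow> reverse_bits i (x mod 2 ^ j) = reverse_bits i x"
proof (induction i)
  case (Suc i)
  have "x mod 2 ^ j div 2 ^ i mod 2 = x div 2 ^ i mod 2"
    using Suc.prems bit_take_bit_iff[of j x i]
    by (auto simp: bit_iff_odd take_bit_eq_mod mod_2_eq_odd)
  then show ?case using Suc by simp
qed simp

text \<open>Source of periodicity: whether a position belongs to level \<open>i\<close> depends only
  on its residue modulo \<open>2 ^ i\<close>.\<close>

lemma reverse_bits_cong_mod:
  assumes "x mod 2 ^ i = y mod 2 ^ i"
  shows "reverse_bits i x = reverse_bits i y"
  using reverse_bits_mod[of i i x] reverse_bits_mod[of i i y] assms by simp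

lemma reverse_bits_eqD: "reverse_bits i x = reverse_bits i y \<Longrightarrow> x mod 2 ^ i = y mod 2 ^ i"
proof (induction i)
  case (Suc i)
  have "2 * a + b = 2 * a' + b' \<Longrightarrow> b < 2 \<Longrightarrow> b' < 2 \<Longrightarrow> a = a' \<and> b = b'" for a a' b b' :: nat
    by presburger
  from this[OF Suc.prems[simplified reverse_bits.simps]]
  have "reverse_bits i x = reverse_bits i y" "x div 2 ^ i mod 2 = y div 2 ^ i mod 2"
    by simp_all
  with Suc.IH show ?case
    by (simp add: mod_mult2_eq[of _ "2 ^ i" 2] power_Suc2 del: power_Suc)
qed simp

lemma inj_on_reverse_bits: "inj_on (reverse_bits i) {..<2 ^ i}"
  by (rule inj_onI) (use reverse_bits_eqD in fastforce)

lemma reverse_bits_image: "reverse_bits i ` {..<2 ^ i} = {..<2 ^ i}"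
  by (rule endo_inj_surj) (auto simp: inj_on_reverse_bits reverse_bits_less)

text \<open>Reading the bits of a position as a binary fraction in [0, 1), least significant bit first,
  level \<open>i\<close> owns the interval of length \<open>L i / 2 ^ i\<close> placed directly after those of the lower
  levels; \<open>offset L i\<close> is \<open>2 ^ i\<close> times its left end.\<close>

primrec offset :: "(nat \<Rightarrow> nat) \<Rightarrow> nat \<Rightarrow> nat" where
  "offset L 0 = 0"
| "offset L (Suc i) = 2 * (offset L i + L i)"

definition in_level :: "(nat \<Rightarrow> nat) \<Rightarrow> nat \<Rightarrow> nat \<Rightarrow> bool" where
  "in_level L i x \<longleftrightarrow> offset L i \<le> reverse_bits i x \<and> reverse_bits i x < offset L i + L i"

text \<open>Reading one more bit replaces the value by its double plus 0 or 1, whereas the right end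
  \<open>offset L k + L k\<close> is exactly doubled. A fraction to the left of that end therefore
  stays to the left of all later intervals.\<close>

lemma in_level_disjoint:
  assumes "in_level L i x" "i < j"
  shows "\<not> in_level L j x"
proof -
  have next_level: "reverse_bits (Suc k) x < offset L (Suc k)"
    if "reverse_bits k x < offset L k + L k" for k
  proof -
    have "2 * m + d < 2 * n" if "m < n" "d < 2" for m n d :: nat using that by linarith
    then show ?thesis using that by simp
  qed
  have "Suc i \<le> j" using assms(2) by simp
  then have "reverse_bits j x < offset L j"
  proof (induction j rule: dec_induct)
    case base
    then show ?case using assms(1) next_level unfolding in_level_def by blast
  next
    case (step k)
    then show ?case using next_level by (meson trans_less_add1)
  qed
  then show ?thesis unfolding in_level_def by simp
qed

lemma offset_eq_sum: "real (offset L i) = 2 ^ i * (\<Sum>j<i. real (L j) / 2 ^ j)"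
  by (induction i) (simp_all add: algebra_simps)

text \<open>The density bound, taken up to and including level \<open>i\<close>, makes its interval
  fit below \<open>2 ^ i\<close>. Bit reversal permutes the residues, so the level has as many
  residues as the interval has integers.\<close>

lemma card_level:
  assumes "\<And>n. (\<Sum>j<n. real (L j) / 2 ^ j) \<le> 1"
  shows "card {x. x < 2 ^ i \<and> in_level L i x} = L i"
proof -
  have "2 * real (offset L i + L i) \<le> 2 * 2 ^ i"
    using offset_eq_sum[of L "Suc i"] mult_left_mono[OF assms[of "Suc i"], of "2 ^ Suc i"] by simp
  then have "real (offset L i + L i) \<le> real (2 ^ i)" by simp
  then have le: "offset L i + L i \<le> 2 ^ i" by (simp only: of_nat_le_iff)
  have "reverse_bits i ` {x. x < 2 ^ i \<and> in_level L i x} = {offset L i..<offset L i + L i}"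
  proof (intro equalityI subsetI)
    fix y assume "y \<in> {offset L i..<offset L i + L i}"
    moreover from this le have "y \<in> reverse_bits i ` {..<2 ^ i}"
      unfolding reverse_bits_image by simp
    ultimately show "y \<in> reverse_bits i ` {x. x < 2 ^ i \<and> in_level L i x}"
      by (auto simp: in_level_def)
  qed (auto simp: in_level_def)
  moreover have "inj_on (reverse_bits i) {x. x < 2 ^ i \<and> in_level L i x}"
    using inj_on_reverse_bits by (rule inj_on_subset) auto
  ultimately show ?thesis using card_image by fastforce
qed

text \<open>A position of level \<open>i\<close> is sent to its residue modulo \<open>2 ^ i\<close>,
  and a position of no level to itself. By disjointness at most one term is nonzero. The range
  suffices, since for \<open>i > m\<close> the residue is \<open>m\<close> itself. Writing it as a
  difference gives computability by a bounded sum and makes \<open>source_le\<close>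
  immediate.\<close>

definition source :: "(nat \<Rightarrow> nat) \<Rightarrow> nat \<Rightarrow> nat" where
  "source L m = m - (\<Sum>i<Suc m. of_bool (in_level L i m) * (m - m mod 2 ^ i))"

lemma source_le: "source L m \<le> m"
  by (simp add: source_def)

lemma source_in_level:
  assumes "in_level L i m"
  shows "source L m = m mod 2 ^ i"
proof -
  have "(\<Sum>j<Suc m. of_bool (in_level L j m) * (m - m mod 2 ^ j)) =
      (\<Sum>j<Suc m. if j = i then m - m mod 2 ^ i else 0)"
    using assms in_level_disjoint by (intro sum.cong) (auto, metis nat_neq_iff)
  also have "\<dots> = (if i < Suc m then m - m mod 2 ^ i else 0)"
    by (simp only: sum.delta finite_lessThan lessThan_iff)
  also have "\<dots> = m - m mod 2 ^ i"
  proof (cases "i < Suc m")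
    case False
    then have "m < 2 ^ i" using less_exp[of i] by linarith
    then show ?thesis using False by simp
  qed simp
  finally show ?thesis unfolding source_def by simp
qed

lemma computable_source:
  assumes "computable L"
  shows "computable_fn (Suc 0) (\<lambda>xs. source L (hd xs))"
proof -
  have "computable_fn k (\<lambda>xs. rec_nat 0 (\<lambda>i A. 2 * (A + L i)) (F xs))"
    if "computable_fn k F" for k F
    by (intro computable_fn_rec computable_fn_intros computable_fn_computable[OF assms] that)
  moreover have "rec_nat 0 (\<lambda>i A. 2 * (A + L i)) i = offset L i" for i by (induction i) auto
  ultimately have offset: "computable_fn k (\<lambda>xs. offset L (F xs))"
    if "computable_fn k F" for k F using that by simp
  have "computable_fn k (\<lambda>xs. rec_nat 0 (\<lambda>i A. 2 * A + G xs div 2 ^ i mod 2) (F xs))"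
    if "computable_fn k F" "computable_fn k G" for k F G
    by (intro computable_fn_rec computable_fn_intros computable_fn_tl_tl that)
  moreover have "rec_nat 0 (\<lambda>i A. 2 * A + x div 2 ^ i mod 2) i = reverse_bits i x" for i x
    by (induction i) auto
  ultimately have reverse: "computable_fn k (\<lambda>xs. reverse_bits (F xs) (G xs))"
    if "computable_fn k F" "computable_fn k G" for k F G using that by simp
  show ?thesis
    unfolding source_def in_level_def
    by (intro computable_fn_sum computable_fn_intros offset reverse
        computable_fn_computable[OF assms])
qed

section \<open>Probabilities of cylinder events and the number of simple strings\<close>

lemma prob_space_coin: "prob_space coin"
  unfolding coin_def by (intro prob_space_PiM measure_pmf.prob_space_axioms)

lemma coin_agree:
  assumes "finite X"
  shows "{r. \<forall>x\<in>X. r x = v x} \<in> sets coin"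
    and "measure coin {r. \<forall>x\<in>X. r x = v x} = (1 / 2) ^ card X"
proof -
  interpret product_prob_space "\<lambda>_. measure_pmf (bernoulli_pmf (1 / 2))" "UNIV :: nat set"
    by standard
  have *: "{r. \<forall>x\<in>X. r x = v x} =
      prod_emb UNIV (\<lambda>_. measure_pmf (bernoulli_pmf (1 / 2))) X (Pi\<^sub>E X (\<lambda>x. {v x}))"
    by (rule set_eqI) (simp add: prod_emb_iff restrict_PiE_iff Pi_iff)
  show "{r. \<forall>x\<in>X. r x = v x} \<in> sets coin"
    unfolding * coin_def using assms by (intro sets_PiM_I) auto
  have "pmf (bernoulli_pmf (1 / 2)) b = 1 / 2" for b by (cases b) auto
  then show "measure coin {r. \<forall>x\<in>X. r x = v x} = (1 / 2) ^ card X"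
    unfolding * coin_def using assms by (subst measure_PiM_emb) (auto simp: measure_pmf_single)
qed

text \<open>Union bound over candidate patterns. Functions in \<open>V\<close> that agree on
  \<open>X\<close> give the same event, which is then merely counted repeatedly.\<close>

lemma coin_agree_some:
  assumes "finite X" "finite V"
  shows "(\<Union>v\<in>V. {r. \<forall>x\<in>X. r x = v x}) \<in> sets coin"
    and "measure coin (\<Union>v\<in>V. {r. \<forall>x\<in>X. r x = v x}) \<le> card V * (1 / 2) ^ card X"
proof -
  interpret prob_space coin by (rule prob_space_coin)
  show "(\<Union>v\<in>V. {r. \<forall>x\<in>X. r x = v x}) \<in> sets coin"
    using assms coin_agree(1) by (intro sets.finite_UN) auto
  have "measure coin (\<Union>v\<in>V. {r. \<forall>x\<in>X. r x = v x}) \<le>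
      (\<Sum>v\<in>V. measure coin {r. \<forall>x\<in>X. r x = v x})"
    using assms coin_agree(1) by (intro finite_measure_subadditive_finite) auto
  also have "\<dots> = card V * (1 / 2) ^ card X"
    using coin_agree(2)[OF assms(1)] by simp
  finally show "measure coin (\<Union>v\<in>V. {r. \<forall>x\<in>X. r x = v x}) \<le> card V * (1 / 2) ^ card X" .
qed

text \<open>Comparison with the identity decompressor gives every string a program, so the
  \<open>LEAST\<close> in \<open>KC\<close> is attained.\<close>

lemma optimal_decompressor_surj:
  assumes "optimal_decompressor D"
  shows "\<exists>p. D p = Some u"
proof -
  have "partial_computable_str Some"
    unfolding partial_computable_str_def partial_computable_def
    by (intro exI[of _ "Id 0"]) (auto elim: eval_IdE intro: eval_Id[of 0 "[_]", simplified])
  then show ?thesis using assms unfolding optimal_decompressor_def by blast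
qed

text \<open>Each such string is the output of a program shorter than \<open>T\<close>, and the codes
  of these programs are distinct numbers below \<open>2 ^ T\<close>.\<close>

lemma KC_less_bound:
  assumes "optimal_decompressor D"
  shows "finite {u. KC D u < T}" "card {u. KC D u < T} \<le> 2 ^ T"
proof -
  have "enc ` {p. length p < T} \<subseteq> {..<2 ^ T}"
  proof clarify
    fix p :: "bool list" assume "length p < T"
    then have "2 ^ Suc (length p) \<le> (2::nat) ^ T" by (intro power_increasing) auto
    then show "enc p < 2 ^ T" using Suc_enc_bounds(2)[of p] by linarith
  qed
  moreover have "inj_on enc {p. length p < T}" by (auto intro: inj_onI inj_enc)
  ultimately have P: "finite {p :: bool list. length p < T}"
      "card {p :: bool list. length p < T} \<le> 2 ^ T"
    using inj_on_finite[of enc _ "{..<2 ^ T}"] card_inj_on_le[of enc _ "{..<2 ^ T}"] by auto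
  have sub: "{u. KC D u < T} \<subseteq> (the \<circ> D) ` {p. length p < T}"
  proof clarify
    fix u assume "KC D u < T"
    have "\<exists>l p. D p = Some u \<and> length p = l" using optimal_decompressor_surj[OF assms] by blast
    from LeastI_ex[OF this] obtain p where "D p = Some u" "length p = KC D u"
      unfolding KC_def by blast
    with \<open>KC D u < T\<close> show "u \<in> (the \<circ> D) ` {p. length p < T}"
      by (intro image_eqI[of _ _ p]) auto
  qed
  show "finite {u. KC D u < T}" using finite_subset[OF sub finite_imageI[OF P(1)]] .
  show "card {u. KC D u < T} \<le> 2 ^ T"
    using card_mono[OF finite_imageI[OF P(1)] sub] card_image_le[OF P(1), of "the \<circ> D"] P(2)
    by linarith
qed

section \<open>Choice of the parameters, construction of the algorithm and almost sure complexity
  bound\<close>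

theorem theorem2:
  fixes a :: "nat \<Rightarrow> rat" and D :: "bool list \<Rightarrow> bool list option"
  assumes "optimal_decompressor D"
    and "computable_rat_seq a"
    and "\<forall>i. a i \<ge> 0"
    and "summable (\<lambda>i. real_of_rat (a i))"
  shows "\<exists>M. prob_algorithm M \<and>
    (AE r in coin. \<exists>\<omega>. outputs_infinite M r \<omega> \<and>
       (\<exists>c::real. \<forall>k n. n > 0 \<longrightarrow>
          real (KC D (substr \<omega> k (k + n)))
            \<ge> real_of_rat (a (nat \<lfloor>log 2 (real n)\<rfloor>)) * real n - c))"
proof -
  from assms(2) obtain p q where pq: "computable p" "computable q"
      and "\<forall>i. q i > 0 \<and> a i = of_nat (p i) / of_nat (q i)"
    unfolding computable_rat_seq_def by (elim exE conjE)
  then have q_pos: "q i > 0" and a: "a i = of_nat (p i) / of_nat (q i)" for i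
    by simp_all
  define b where "b i = real_of_rat (a i)" for i
  have b: "b i = real (p i) / real (q i)" for i
    unfolding b_def a by (simp add: of_rat_divide)
  have b_nonneg: "b i \<ge> 0" for i unfolding b by simp
  \<comment> \<open>An integer threshold just above \<open>b i * 2 ^ Suc i\<close>, which bounds
    \<open>b i * n\<close> for every length \<open>n\<close> of level \<open>i\<close>. Integer
    division of numerator by denominator keeps it computable.\<close>
  define T where "T i = Suc (2 ^ Suc i * p i div q i)" for i
  have T_lower: "b i * 2 ^ Suc i \<le> real (T i)" for i
  proof -
    have "2 ^ Suc i * p i < T i * q i"
      unfolding T_def using q_pos[of i] by (simp only: dividend_less_div_times mult_Suc)
    then have "real (2 ^ Suc i * p i) \<le> real (T i * q i)"
      by (simp only: of_nat_le_iff less_imp_le)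
    then show ?thesis unfolding b using q_pos[of i] by (simp add: field_simps)
  qed
  have T_upper: "real (T i) \<le> b i * 2 ^ Suc i + 1" for i
    using of_nat_div_le_of_nat[of "2 ^ Suc i * p i" "q i", where 'a = real]
    unfolding T_def b by (simp add: field_simps)
  \<comment> \<open>The density of a level that stores \<open>T i + 2 * i\<close> bits. Of the extra
    bits, \<open>i\<close> pay for the \<open>2 ^ i\<close> possible starting residues and
    \<open>i\<close> give the failure probability \<open>(1 / 2) ^ i\<close>.\<close>
  define f where "f i = (real (T i) + 2 * real i) / 2 ^ i" for i
  have "summable f"
  proof (rule summable_comparison_test')
    have "summable (\<lambda>i. real (Suc i) * (1 / 2) ^ i)"
      using geometric_deriv_sums[of "1 / 2 :: real"] by (auto intro: sums_summable)
    then show "summable (\<lambda>i. 2 * b i + 2 * (real (Suc i) * (1 / 2) ^ i))"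
      using assms(4) unfolding b_def by (intro summable_add summable_mult)
    show "norm (f i) \<le> 2 * b i + 2 * (real (Suc i) * (1 / 2) ^ i)" for i
    proof -
      have "real (T i) + 2 * real i \<le> (2 * b i + 2 * (real (Suc i) * (1 / 2) ^ i)) * 2 ^ i"
        using T_upper[of i] by (simp add: algebra_simps power_one_over add_divide_distrib)
      then show ?thesis unfolding f_def by (simp add: pos_divide_le_eq)
    qed
  qed
  \<comment> \<open>The tail of the density series from \<open>N\<close> on is below 1; levels
    before \<open>N\<close> are left empty, so all the intervals fit into [0, 1).\<close>
  then obtain N where N: "\<And>n. norm (sum f {N..<n}) < 1"
    using summable_Cauchy[THEN iffD1, rule_format, of f 1] by auto
  define L where "L i = of_bool (N \<le> i) * (T i + 2 * i)" for i
  have L_sum: "(\<Sum>j<n. real (L j) / 2 ^ j) \<le> 1" for n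
  proof -
    have "(\<Sum>j<n. real (L j) / 2 ^ j) = (\<Sum>j<n. if j \<in> {N..} then f j else 0)"
      by (intro sum.cong) (auto simp: L_def f_def)
    also have "\<dots> = sum f ({..<n} \<inter> {N..})" by (rule sum.inter_restrict[symmetric]) simp
    also have "{..<n} \<inter> {N..} = {N..<n}" by auto
    finally show ?thesis using N[of n] by simp
  qed
  \<comment> \<open>The input positions whose bits are repeated throughout level
    \<open>i\<close>.\<close>
  define X where "X i = {x. x < 2 ^ i \<and> in_level L i x}" for i
  have fin_X: "finite (X i)" for i unfolding X_def by simp
  have card_X: "card (X i) = L i" for i unfolding X_def by (rule card_level[of L, OF L_sum])
  have "computable L"
    unfolding L_def T_def
    by (intro computableI computable_fn_intros computable_fn_computable[OF pq(1)]
        computable_fn_computable[OF pq(2)])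
  define M where "M r = map (\<lambda>m. r ! source L m) [0..<length r]" for r :: "bool list"
  define \<omega> where "\<omega> r m = r (source L m)" for r :: "nat \<Rightarrow> bool" and m
  have source_less: "source L m < n" if "m < n" for m n
    using source_le[of L m] that by linarith
  have M_upto: "M (map r [0..<n]) = map (\<omega> r) [0..<n]" for r n
    unfolding M_def \<omega>_def by (simp add: source_less)
  have "prob_algorithm M"
    unfolding prob_algorithm_def
  proof (intro conjI allI impI)
    show "computable_str M"
      unfolding M_def
      using computable_str_map_nth[OF computable_source[OF \<open>computable L\<close>] source_le] .
    fix r s :: "bool list" assume "prefix r s"
    then obtain t where s: "s = r @ t" by (auto simp: prefix_def)
    have "take (length r) (M s) = M r"
      unfolding M_def s by (simp add: take_map nth_append source_less)
    then show "prefix (M r) (M s)" by (metis take_is_prefix)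
  qed
  have outputs: "outputs_infinite M r (\<omega> r)" for r
    unfolding outputs_infinite_def M_upto
  proof
    show "\<exists>n. i < length (map (\<omega> r) [0..<n]) \<and> map (\<omega> r) [0..<n] ! i = \<omega> r i" for i
      by (intro exI[of _ "Suc i"]) (simp del: upt_Suc)
  qed

  \<comment> \<open>the values on \<open>X i\<close> read off from a simple substring \<open>u\<close> whose start is \<open>d\<close> modulo \<open>2 ^ i\<close>\<close>
  define V where "V i = (\<lambda>(u, d) x. u ! ((x + (2 ^ i - d)) mod 2 ^ i)) `
      ({u. KC D u < T i} \<times> {..<2 ^ i})" for i
  have fin_V: "finite (V i)" for i
    unfolding V_def using KC_less_bound(1)[OF assms(1)] by simp
  have card_V: "card (V i) \<le> 2 ^ T i * 2 ^ i" for i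
  proof -
    have "card (V i) \<le> card ({u. KC D u < T i} \<times> {..<2 ^ i :: nat})"
      unfolding V_def using KC_less_bound(1)[OF assms(1)] by (intro card_image_le) simp
    also have "\<dots> = card {u. KC D u < T i} * 2 ^ i" by (simp add: card_cartesian_product)
    also have "\<dots> \<le> 2 ^ T i * 2 ^ i"
      using KC_less_bound(2)[OF assms(1)] by (rule mult_le_mono1)
    finally show ?thesis .
  qed
  \<comment> \<open>The bad event: it contains every outcome with a substring of length at least
    \<open>2 ^ i\<close> and complexity below \<open>T i\<close>. The infinitely many starting
    positions matter only modulo \<open>2 ^ i\<close>, so finitely many patterns suffice.\<close>
  define B where "B i = (\<Union>v\<in>V i. {r. \<forall>x\<in>X i. r x = v x})" for i
  have B_prob: "measure coin (B i) \<le> (1 / 2) ^ i" if "N \<le> i" for i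
  proof -
    have "measure coin (B i) \<le> card (V i) * (1 / 2) ^ L i"
      unfolding B_def card_X[symmetric] by (rule coin_agree_some(2)[OF fin_X fin_V])
    also have "\<dots> \<le> (2 ^ T i * 2 ^ i) * (1 / 2) ^ L i"
    proof (rule mult_right_mono)
      have "real (card (V i)) \<le> real (2 ^ T i * 2 ^ i)"
        using card_V[of i] by (simp only: of_nat_le_iff)
      then show "real (card (V i)) \<le> 2 ^ T i * 2 ^ i" by simp
    qed simp
    \<comment> \<open>Here \<open>L i = T i + i + i\<close>: the threshold and one copy of
      \<open>i\<close> cancel the number of patterns, and the other copy remains.\<close>
    also have "\<dots> = (2 * (1 / 2)) ^ T i * (2 * (1 / 2)) ^ i * (1 / 2) ^ i"
      using that unfolding L_def power_mult_distrib by (simp add: power_add mult_2)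
    also have "\<dots> = (1 / 2) ^ i" by simp
    finally show ?thesis .
  qed
  interpret prob_space coin by (rule prob_space_coin)
  have "AE r in coin. eventually (\<lambda>i. r \<in> space coin - B i) sequentially"
  proof (rule borel_cantelli_AE1)
    show "B i \<in> sets coin" for i unfolding B_def by (rule coin_agree_some(1)[OF fin_X fin_V])
    show "summable (\<lambda>i. measure coin (B i))"
      by (rule summable_comparison_test'[of "\<lambda>i. (1 / 2) ^ i" N])
        (use B_prob in \<open>auto intro: summable_geometric\<close>)
  qed (simp add: less_top[symmetric])
  then have "AE r in coin. \<exists>\<omega>. outputs_infinite M r \<omega> \<and> (\<exists>c::real. \<forall>k n. n > 0 \<longrightarrow>
      real (KC D (substr \<omega> k (k + n))) \<ge> b (nat \<lfloor>log 2 (real n)\<rfloor>) * real n - c)"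
  proof (rule AE_mp, intro AE_I2 impI)
    fix r assume "\<forall>\<^sub>F i in sequentially. r \<in> space coin - B i"
    then obtain I0 where I0: "\<And>i. i \<ge> I0 \<Longrightarrow> r \<notin> B i" unfolding eventually_sequentially by auto
    define I where "I = max I0 N"
    \<comment> \<open>On a level below \<open>I\<close> the demand \<open>b i * n\<close> is at most
      one summand of \<open>c\<close>, so the claim there reduces to nonnegativity of complexity.
      Through \<open>I0\<close> the constant depends on the outcome \<open>r\<close>.\<close>
    define c where "c = (\<Sum>i<I. b i * 2 ^ Suc i)"
    have c_nonneg: "c \<ge> 0" unfolding c_def using b_nonneg by (intro sum_nonneg) simp
    have "real (KC D (substr (\<omega> r) k (k + n))) \<ge> b (nat \<lfloor>log 2 (real n)\<rfloor>) * real n - c"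
      if "n > 0" for k n
    proof -
      define i where "i = nat \<lfloor>log 2 (real n)\<rfloor>"
      define u where "u = substr (\<omega> r) k (k + n)"
      have "\<lfloor>log 2 (real n)\<rfloor> = int i" using that unfolding i_def by simp
      then have n: "2 ^ i \<le> n" "n < 2 ^ Suc i"
        using floor_log_nat_eq_powr_iff[of 2 n i] that by (auto simp: powr_realpow)
      have "real n \<le> real (2 ^ Suc i)"
        using n(2) by (simp only: of_nat_le_iff less_imp_le)
      then have bn: "b i * real n \<le> b i * 2 ^ Suc i"
        using b_nonneg[of i] by (intro mult_left_mono) simp_all
      have "b i * real n - c \<le> real (KC D u)"
      proof (cases "i < I")
        case True
        then have "b i * 2 ^ Suc i \<le> c"
          unfolding c_def using b_nonneg by (intro member_le_sum) auto
        then show ?thesis using bn by linarith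
      next
        case False
        show ?thesis
        proof (rule ccontr)
          assume "\<not> ?thesis"
          then have "real (KC D u) < real (T i)" using bn c_nonneg T_lower[of i] by linarith
          then have "KC D u < T i" by simp
          define d where "d = k mod 2 ^ i"
          \<comment> \<open>\<open>t x\<close> is the index in \<open>u\<close> of the position
            congruent to \<open>x\<close> modulo \<open>2 ^ i\<close> among the first
            \<open>2 ^ i\<close> positions of the substring. Adding \<open>2 ^ i - d\<close>
            replaces subtracting \<open>d\<close>, which would be truncated on natural
            numbers.\<close>
          define t where "t x = (x + (2 ^ i - d)) mod 2 ^ i" for x
          have "d < 2 ^ i" unfolding d_def by simp
          have "r x = u ! t x" if "x \<in> X i" for x
          proof -
            have x: "x < 2 ^ i" "in_level L i x" using that unfolding X_def by auto
            have "t x < n" using n(1) unfolding t_def by (meson less_le_trans mod_less_divisor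
                  zero_less_numeral zero_less_power)
            have "(k + t x) mod 2 ^ i = (d + (x + (2 ^ i - d))) mod 2 ^ i"
              unfolding t_def d_def by (simp add: mod_add_left_eq mod_add_right_eq)
            also have "\<dots> = x" using x(1) \<open>d < 2 ^ i\<close> by simp
            finally have mod: "(k + t x) mod 2 ^ i = x" .
            then have "reverse_bits i (k + t x) = reverse_bits i x"
              using x(1) by (intro reverse_bits_cong_mod) simp
            then have "in_level L i (k + t x)" using x(2) unfolding in_level_def by simp
            then have "\<omega> r (k + t x) = r x" unfolding \<omega>_def by (simp add: source_in_level mod)
            then show ?thesis using \<open>t x < n\<close> unfolding u_def substr_def by simp
          qed
          moreover have "(\<lambda>x. u ! t x) \<in> V i"
            unfolding V_def t_def using \<open>KC D u < T i\<close> \<open>d < 2 ^ i\<close>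
            by (intro image_eqI[of _ _ "(u, d)"]) auto
          ultimately have "r \<in> B i" unfolding B_def by blast
          then show False using I0[of i] False unfolding I_def by simp
        qed
      qed
      then show ?thesis unfolding i_def u_def .
    qed
    with outputs show "\<exists>\<omega>. outputs_infinite M r \<omega> \<and> (\<exists>c::real. \<forall>k n. n > 0 \<longrightarrow>
      real (KC D (substr \<omega> k (k + n))) \<ge> b (nat \<lfloor>log 2 (real n)\<rfloor>) * real n - c)"
      by blast
  qed
  with \<open>prob_algorithm M\<close> show ?thesis unfolding b_def by blast
qed

end
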